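(* Let $G$ be an $n$-vertex graph whose adjacency matrix has minimum eigenvalue $\lambda<0$, and let $S$ be an independent set of $G$ such that every vertex $i\notin S$ satisfies \[ |\{j: \{i,j\}\in E(G),\ j\in S\}|\geq -\lambda. \] Then $\alpha(G)=\Theta(G)=\vartheta(G)=|S|$.
   Context: $\alpha(G)$ is the independence number. For a graph $G$, $G^k$ is the graph on $V(G)^k$ in which distinct $u_1\cdots u_k$ and $v_1\cdots v_k$ are adjacent iff for each $i$ either $u_i=v_i$ or $\{u_i,v_i\}\in E(G)$; the Shannon capacity is $\Theta(G)=\sup_k \alpha(G^k)^{1/k}$. An orthonormal representation of an $n$-vertex graph $G$ is a set of unit real vectors $\{u_1,\dots,u_n\}$ with $u_i^\top u_j=0$ whenever $i,j$ are distinct nonadjacent vertices; its value is $\min_c\max_i 1/(c^\top u_i)^2$ over unit real vectors $c$; the Lov\'{a}sz number $\vartheta(G)$ is the minimum value over all orthonormal representations of $G$. *)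

theory Defs
  imports
    "Graph_Theory.Graph_Theory"
    "Jordan_Normal_Form.Char_Poly"
    "HOL-Library.Extended_Nonnegative_Real"
begin

text \<open>
  A finite simple graph is a \<open>'a pair_pre_digraph\<close> satisfying \<open>pair_graph\<close>: finite, loopless, and
  with a symmetric arc set, so that \<open>(i, j) \<in> parcs G\<close> says that \<open>{i, j}\<close> is an edge.
\<close>

definition independent_set :: "'a pair_pre_digraph \<Rightarrow> 'a set \<Rightarrow> bool" where
  "independent_set G S \<longleftrightarrow> S \<subseteq> pverts G \<and> (\<forall>i\<in>S. \<forall>j\<in>S. (i, j) \<notin> parcs G)"

definition independence_number :: "'a pair_pre_digraph \<Rightarrow> nat" where
  "independence_number G = Max (card ` {S. independent_set G S})"

definition strong_power :: "'a pair_pre_digraph \<Rightarrow> nat \<Rightarrow> 'a list pair_pre_digraph" where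
  "strong_power G k =
     (let V = {us. length us = k \<and> set us \<subseteq> pverts G}
      in \<lparr> pverts = V,
           parcs = {(us, vs). us \<in> V \<and> vs \<in> V \<and> us \<noteq> vs \<and>
                      (\<forall>i<k. us ! i = vs ! i \<or> (us ! i, vs ! i) \<in> parcs G)} \<rparr>)"

text \<open>The supremum below is over a bounded set; see \<open>bdd_above_shannon\<close>.\<close>

definition shannon_capacity :: "'a pair_pre_digraph \<Rightarrow> real" where
  "shannon_capacity G = (SUP k\<in>{1..}. root k (real (independence_number (strong_power G k))))"

text \<open>
  The matrix is indexed by positions in an enumeration \<open>vs\<close> of the vertices.
\<close>

definition adjacency_matrix :: "'a pair_pre_digraph \<Rightarrow> 'a list \<Rightarrow> real mat" where
  "adjacency_matrix G vs =
     mat (length vs) (length vs) (\<lambda>(i, j). if (vs ! i, vs ! j) \<in> parcs G then 1 else 0)"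

definition unit_vecs :: "nat \<Rightarrow> real vec set" where
  "unit_vecs d = {c \<in> carrier_vec d. c \<bullet> c = 1}"

definition orthonormal_representation ::
    "'a pair_pre_digraph \<Rightarrow> nat \<Rightarrow> ('a \<Rightarrow> real vec) \<Rightarrow> bool" where
  "orthonormal_representation G d u \<longleftrightarrow>
     (\<forall>i\<in>pverts G. u i \<in> unit_vecs d) \<and>
     (\<forall>i\<in>pverts G. \<forall>j\<in>pverts G. i \<noteq> j \<longrightarrow> (i, j) \<notin> parcs G \<longrightarrow> u i \<bullet> u j = 0)"

text \<open>
  Values lie in \<open>ennreal\<close>, where \<open>1 / 0 = \<infinity>\<close>, so a vector \<open>c\<close> orthogonal to some \<open>u i\<close> never
  does better than one that is not. By compactness (after passing to the span of the
  representation, so that the dimension is at most the number of vertices) the infima in the next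
  two definitions are minima.
\<close>

definition representation_value :: "'a pair_pre_digraph \<Rightarrow> nat \<Rightarrow> ('a \<Rightarrow> real vec) \<Rightarrow> ennreal" where
  "representation_value G d u =
     (INF c\<in>unit_vecs d. MAX i\<in>pverts G. 1 / ennreal ((c \<bullet> u i)\<^sup>2))"

definition lovasz_number :: "'a pair_pre_digraph \<Rightarrow> ennreal" where
  "lovasz_number G = Inf {representation_value G d u | d u. orthonormal_representation G d u}"

lemma pair_graph_strong_power:
  assumes "pair_graph G"
  shows "pair_graph (strong_power G k)"
proof -
  interpret pair_graph G by fact
  let ?V = "{us. length us = k \<and> set us \<subseteq> pverts G}"
  have fin: "finite ?V"
    using finite_lists_length_eq[OF pair_finite_verts, of k] by (simp add: conj_commute)
  have fin_arcs: "finite (parcs (strong_power G k))"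
    by (rule finite_subset[of _ "?V \<times> ?V"]) (auto simp: strong_power_def Let_def fin)
  have sym: "(us ! i, vs ! i) \<in> parcs G \<Longrightarrow> (vs ! i, us ! i) \<in> parcs G" for us vs i
    using pair_sym_arcs by (auto simp: symmetric_def dest: symD)
  have "sym (parcs (strong_power G k))"
    by (rule symI) (auto simp: strong_power_def Let_def, metis sym)
  then show ?thesis
    using fin fin_arcs
    by unfold_locales (auto simp: strong_power_def Let_def symmetric_def)
qed

lemma independence_number_le:
  assumes "finite (pverts G)"
  shows "independence_number G \<le> card (pverts G)"
proof -
  have "finite (Collect (independent_set G))"
    by (rule finite_subset[of _ "Pow (pverts G)"]) (auto simp: independent_set_def assms)
  moreover have "independent_set G {}"
    by (simp add: independent_set_def)
  moreover have "card S \<le> card (pverts G)" if "independent_set G S" for S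
    using that assms by (auto simp: independent_set_def intro: card_mono)
  ultimately show ?thesis
    unfolding independence_number_def by (subst Max_le_iff) auto
qed

lemma bdd_above_shannon:
  assumes "finite (pverts G)"
  shows "bdd_above ((\<lambda>k. root k (real (independence_number (strong_power G k)))) ` {1..})"
proof (rule bdd_aboveI2)
  fix k :: nat assume k: "k \<in> {1..}"
  have verts: "pverts (strong_power G k) = {us. set us \<subseteq> pverts G \<and> length us = k}"
    by (auto simp: strong_power_def)
  have "independence_number (strong_power G k) \<le> card (pverts G) ^ k"
    using independence_number_le[of "strong_power G k"] assms
    by (simp add: verts finite_lists_length_eq card_lists_length_eq)
  then have "real (independence_number (strong_power G k)) \<le> real (card (pverts G)) ^ k"
    by (metis of_nat_le_iff of_nat_power)
  then have "root k (real (independence_number (strong_power G k)))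
      \<le> root k (real (card (pverts G)) ^ k)"
    using k by (intro real_root_le_mono) auto
  also have "\<dots> = real (card (pverts G))"
    using k by (intro real_root_power_cancel) auto
  finally show "root k (real (independence_number (strong_power G k))) \<le> real (card (pverts G))" .
qed

end

theory Submission
  imports Defs
begin

text \<open>
  One has \<open>card S \<le> \<alpha> \<le> \<Theta> \<le> \<vartheta> \<le> card S\<close>. For \<open>\<Theta> \<le> \<vartheta>\<close>, tensor powers of an orthonormal
  representation assign orthonormal vectors to an independent set of \<open>G\<^sup>k\<close>, and Bessel's inequality
  applies to the tensor power of \<open>c\<close>. For \<open>\<vartheta> \<le> card S\<close>, the matrix \<open>I - A / lam\<close> is positive
  semidefinite, hence the Gram matrix of an orthonormal representation \<open>u\<close>. The vectors
  \<open>u s\<close> for \<open>s \<in> S\<close> are orthonormal, and their normalised sum \<open>c\<close> satisfies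
  \<open>c \<bullet> u i \<ge> 1 / sqrt (card S)\<close> for every vertex \<open>i\<close>: with equality on \<open>S\<close>, and by the hypothesis on
  the number of neighbours in \<open>S\<close> elsewhere.
\<close>

section \<open>Bessel's inequality for finite orthonormal families\<close>

text \<open>The orthogonal projection \<open>p\<close> of \<open>c\<close> onto the span of the
  \<open>w t\<close> satisfies \<open>c \<bullet> p = p \<bullet> p\<close>, both being the sum of
  the squared coefficients \<open>a t\<close>, so the claim is that the squared norm of
  \<open>c - p\<close> is nonnegative. Using functions on an arbitrary finite index set lets it
  apply directly to tensors.\<close>

lemma bessel_inequality:
  fixes w :: "'b \<Rightarrow> 'i \<Rightarrow> real" and c :: "'i \<Rightarrow> real"
  assumes "finite P" "finite T"
    and orth: "\<And>s t. s \<in> T \<Longrightarrow> t \<in> T \<Longrightarrow> (\<Sum>x\<in>P. w s x * w t x) = (if s = t then 1 else 0)"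
  shows "(\<Sum>t\<in>T. (\<Sum>x\<in>P. c x * w t x)\<^sup>2) \<le> (\<Sum>x\<in>P. (c x)\<^sup>2)"
proof -
  define a where "a t = (\<Sum>x\<in>P. c x * w t x)" for t
  define p where "p x = (\<Sum>t\<in>T. a t * w t x)" for x
  have cp: "(\<Sum>x\<in>P. c x * p x) = (\<Sum>t\<in>T. (a t)\<^sup>2)"
  proof -
    have "(\<Sum>x\<in>P. c x * p x) = (\<Sum>t\<in>T. \<Sum>x\<in>P. c x * (a t * w t x))"
      unfolding p_def sum_distrib_left by (rule sum.swap)
    also have "\<dots> = (\<Sum>t\<in>T. a t * a t)"
      by (subst (3) a_def) (simp add: sum_distrib_left mult_ac)
    finally show ?thesis by (simp add: power2_eq_square)
  qed
  have wp: "(\<Sum>x\<in>P. w s x * p x) = a s" if "s \<in> T" for s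
  proof -
    have "(\<Sum>x\<in>P. w s x * p x) = (\<Sum>t\<in>T. \<Sum>x\<in>P. w s x * (a t * w t x))"
      unfolding p_def sum_distrib_left by (rule sum.swap)
    also have "\<dots> = (\<Sum>t\<in>T. a t * (\<Sum>x\<in>P. w s x * w t x))"
      by (simp add: sum_distrib_left mult_ac)
    also have "\<dots> = (\<Sum>t\<in>T. if s = t then a t else 0)"
      by (rule sum.cong) (auto simp: orth that)
    finally show ?thesis using assms(2) that by simp
  qed
  have pp: "(\<Sum>x\<in>P. p x * p x) = (\<Sum>t\<in>T. (a t)\<^sup>2)"
  proof -
    have "(\<Sum>x\<in>P. p x * p x) = (\<Sum>x\<in>P. \<Sum>s\<in>T. a s * (w s x * p x))"
      by (intro sum.cong) (simp_all add: p_def sum_distrib_right mult_ac)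
    also have "\<dots> = (\<Sum>s\<in>T. \<Sum>x\<in>P. a s * (w s x * p x))"
      by (rule sum.swap)
    also have "\<dots> = (\<Sum>s\<in>T. a s * a s)"
      by (simp add: wp flip: sum_distrib_left)
    finally show ?thesis by (simp add: power2_eq_square)
  qed
  have "0 \<le> (\<Sum>x\<in>P. (c x - p x)\<^sup>2)"
    by (intro sum_nonneg) simp
  also have "\<dots> = (\<Sum>x\<in>P. (c x)\<^sup>2) - 2 * (\<Sum>x\<in>P. c x * p x) + (\<Sum>x\<in>P. p x * p x)"
    by (simp add: power2_eq_square algebra_simps sum.distrib sum_subtractf sum_distrib_left)
  also have "\<dots> = (\<Sum>x\<in>P. (c x)\<^sup>2) - (\<Sum>t\<in>T. (a t)\<^sup>2)"
    by (simp add: cp pp)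
  finally show ?thesis by (simp add: a_def)
qed

section \<open>Independent sets and the lower bound for the Shannon capacity\<close>

lemma finite_independent_sets:
  "finite (pverts G) \<Longrightarrow> finite {S. independent_set G S}"
  by (rule finite_subset[of _ "Pow (pverts G)"]) (auto simp: independent_set_def)

lemma card_le_independence_number:
  assumes "finite (pverts G)" "independent_set G S"
  shows "card S \<le> independence_number G"
  unfolding independence_number_def
  using assms finite_independent_sets by (intro Max_ge) auto

lemma independence_number_leI:
  assumes "finite (pverts G)" "\<And>S. independent_set G S \<Longrightarrow> card S \<le> m"
  shows "independence_number G \<le> m"
proof -
  have "independent_set G {}" by (simp add: independent_set_def)
  then show ?thesis
    unfolding independence_number_def
    using assms finite_independent_sets[of G] by (subst Max_le_iff) auto
qed

lemma finite_strong_power: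
  "finite (pverts G) \<Longrightarrow> finite (pverts (strong_power G k))"
  using finite_lists_length_eq[of "pverts G" k] by (simp add: strong_power_def conj_commute)

text \<open>This is the term \<open>k = 1\<close> of the supremum: one-element lists embed
  \<open>G\<close> in its first strong power.\<close>

lemma independence_number_le_shannon_capacity:
  assumes "finite (pverts G)"
  shows "real (independence_number G) \<le> shannon_capacity G"
proof -
  have "independence_number G \<le> independence_number (strong_power G 1)"
  proof (rule independence_number_leI[OF assms])
    fix S assume S: "independent_set G S"
    have "card S = card ((\<lambda>v. [v]) ` S)"
      by (simp add: card_image inj_on_def)
    also have "\<dots> \<le> independence_number (strong_power G 1)"
      by (rule card_le_independence_number[OF finite_strong_power[OF assms]])
        (use S in \<open>auto simp: independent_set_def strong_power_def\<close>)
    finally show "card S \<le> independence_number (strong_power G 1)" .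
  qed
  then have "real (independence_number G) \<le> root 1 (real (independence_number (strong_power G 1)))"
    by simp
  also have "\<dots> \<le> shannon_capacity G"
    unfolding shannon_capacity_def
    by (rule cSUP_upper[OF _ bdd_above_shannon[OF assms]]) simp
  finally show ?thesis .
qed

section \<open>The Lovasz number as an upper bound for the Shannon capacity\<close>

text \<open>The tensor product of \<open>u (t ! 0), \<dots>, u (t ! (k - 1))\<close> is encoded as the function
  \<open>g \<mapsto> \<Prod>j<k. u (t ! j) $ g j\<close> on \<open>{..<k} \<rightarrow>\<^sub>E {0..<d}\<close>; inner products of such functions
  factor over the coordinates by \<open>prod_sum_PiE\<close>.\<close>

lemma independent_strong_power_card_le:
  assumes fin: "finite (pverts G)"
    and u: "orthonormal_representation G d u"
    and c: "c \<in> unit_vecs d"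
    and r: "r > 0" "\<And>i. i \<in> pverts G \<Longrightarrow> 1 / r \<le> (c \<bullet> u i)\<^sup>2"
    and T: "independent_set (strong_power G k) T"
  shows "real (card T) \<le> r ^ k"
proof -
  let ?P = "{..<k} \<rightarrow>\<^sub>E {0..<d}"
  have finP: "finite ?P" by (intro finite_PiE) auto
  have TV: "T \<subseteq> pverts (strong_power G k)" using T by (simp add: independent_set_def)
  then have finT: "finite T" using finite_strong_power[OF fin] finite_subset by blast
  have vert: "t ! j \<in> pverts G" if "t \<in> T" "j < k" for t j
    using that TV nth_mem[of j t] by (fastforce simp: strong_power_def)
  have dim: "dim_vec (u i) = d" if "i \<in> pverts G" for i
    using u that by (auto simp: orthonormal_representation_def unit_vecs_def)
  define w where "w t g = (\<Prod>j<k. u (t ! j) $ g j)" for t and g :: "nat \<Rightarrow> nat"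
  define cc where "cc g = (\<Prod>j<k. c $ g j)" for g :: "nat \<Rightarrow> nat"
  have ww: "(\<Sum>g\<in>?P. w s g * w t g) = (\<Prod>j<k. u (s ! j) \<bullet> u (t ! j))" if "t \<in> T" for s t
    using dim vert that
    by (simp add: w_def scalar_prod_def prod_sum_PiE flip: prod.distrib)
  have cw: "(\<Sum>g\<in>?P. cc g * w t g) = (\<Prod>j<k. c \<bullet> u (t ! j))" if "t \<in> T" for t
    using dim vert that
    by (simp add: w_def cc_def scalar_prod_def prod_sum_PiE flip: prod.distrib)
  have dimc: "dim_vec c = d" using c by (simp add: unit_vecs_def)
  have "(\<Sum>g\<in>?P. (cc g)\<^sup>2) = (\<Prod>j<k. c \<bullet> c)"
    using dimc by (simp add: cc_def scalar_prod_def prod_sum_PiE power2_eq_square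
        del: prod_constant flip: prod.distrib)
  also have "\<dots> = 1" using c by (simp add: unit_vecs_def)
  finally have cc1: "(\<Sum>g\<in>?P. (cc g)\<^sup>2) = 1" .
  have orth: "(\<Sum>g\<in>?P. w s g * w t g) = (if s = t then 1 else 0)" if st: "s \<in> T" "t \<in> T" for s t
  proof (cases "s = t")
    case True
    have "u (t ! j) \<bullet> u (t ! j) = 1" if "j < k" for j
      using u vert[OF st(2) that] by (auto simp: orthonormal_representation_def unit_vecs_def)
    then show ?thesis using True st by (simp add: ww)
  next
    case False
    \<comment> \<open>Distinct nonadjacent tuples have a coordinate where the entries are distinct
      and nonadjacent; its zero factor kills the whole product.\<close>
    have "(s, t) \<notin> parcs (strong_power G k)" using T st by (auto simp: independent_set_def)
    then obtain j where j: "j < k" "s ! j \<noteq> t ! j" "(s ! j, t ! j) \<notin> parcs G"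
      using False st TV by (auto simp: strong_power_def)
    then have "u (s ! j) \<bullet> u (t ! j) = 0"
      using u vert[OF st(1) j(1)] vert[OF st(2) j(1)] by (auto simp: orthonormal_representation_def)
    then have "(\<Prod>j<k. u (s ! j) \<bullet> u (t ! j)) = 0"
      using j(1) by auto
    then show ?thesis using False st by (simp add: ww)
  qed
  \<comment> \<open>Each tensor indexed by \<open>T\<close> has squared inner product at least
    \<open>(1 / r) ^ k\<close> with the unit tensor \<open>cc\<close>; Bessel bounds the total by
    1.\<close>
  have "real (card T) * (1 / r) ^ k = (\<Sum>t\<in>T. (1 / r) ^ k)" by simp
  also have "\<dots> \<le> (\<Sum>t\<in>T. (\<Sum>g\<in>?P. cc g * w t g)\<^sup>2)"
  proof (rule sum_mono)
    fix t assume t: "t \<in> T"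
    have "(1 / r) ^ k = (\<Prod>j<k. 1 / r)" by simp
    also have "\<dots> \<le> (\<Prod>j<k. (c \<bullet> u (t ! j))\<^sup>2)"
      using r vert[OF t] by (intro prod_mono) auto
    finally show "(1 / r) ^ k \<le> (\<Sum>g\<in>?P. cc g * w t g)\<^sup>2"
      by (simp add: cw[OF t] prod_power_distrib)
  qed
  also have "\<dots> \<le> 1"
    using bessel_inequality[OF finP finT orth, of cc] cc1 by simp
  finally show ?thesis using r(1) by (simp add: power_one_over field_simps)
qed

text \<open>A finite value \<open>r\<close> attained at a unit vector \<open>c\<close> bounds the
  independence number of every \<open>k\<close>-th strong power by \<open>r ^ k\<close>, so all the
  \<open>k\<close>-th roots are at most \<open>r\<close>. A vertex is used to see that
  \<open>r\<close> is positive.\<close>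

lemma shannon_capacity_le_lovasz_number:
  assumes fin: "finite (pverts G)" and ne: "pverts G \<noteq> {}"
  shows "ennreal (shannon_capacity G) \<le> lovasz_number G"
  unfolding lovasz_number_def
proof (rule Inf_greatest, clarify)
  fix d u assume u: "orthonormal_representation G d u"
  show "ennreal (shannon_capacity G) \<le> representation_value G d u"
    unfolding representation_value_def
  proof (rule INF_greatest)
    fix c assume c: "c \<in> unit_vecs d"
    define m where "m = (MAX i\<in>pverts G. 1 / ennreal ((c \<bullet> u i)\<^sup>2))"
    have m: "1 / ennreal ((c \<bullet> u i)\<^sup>2) \<le> m" if "i \<in> pverts G" for i
      unfolding m_def using fin that by (intro Max_ge) auto
    show "ennreal (shannon_capacity G) \<le> m"
    proof (cases m)
      case top
      then show ?thesis by simp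
    next
      case (real r)
      \<comment> \<open>Finiteness of \<open>m\<close> excludes \<open>c \<bullet> u i = 0\<close>,
        since \<open>1 / 0\<close> is infinite in \<open>ennreal\<close>; the inequality can then be
        moved to the reals.\<close>
      have *: "r > 0 \<and> 1 / r \<le> (c \<bullet> u i)\<^sup>2" if i: "i \<in> pverts G" for i
      proof -
        have nz: "(c \<bullet> u i)\<^sup>2 > 0"
          using m[OF i] real by (cases "c \<bullet> u i = 0") (auto simp: top_unique)
        then have "ennreal (1 / (c \<bullet> u i)\<^sup>2) \<le> ennreal r"
          using m[OF i] real by (simp add: divide_ennreal flip: ennreal_1)
        then have le: "1 / (c \<bullet> u i)\<^sup>2 \<le> r" using real by (simp add: ennreal_le_iff)
        moreover have "1 / (c \<bullet> u i)\<^sup>2 > 0" using nz by simp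
        ultimately have "r > 0" by linarith
        then show ?thesis using le nz by (simp add: field_simps)
      qed
      have "r > 0" using * ne by blast
      have "shannon_capacity G \<le> r"
        unfolding shannon_capacity_def
      proof (rule cSUP_least)
        fix k :: nat assume k: "k \<in> {1..}"
        \<comment> \<open>The floor turns the real bound \<open>r ^ k\<close> into a natural number,
          as a bound on cardinalities requires.\<close>
        have "independence_number (strong_power G k) \<le> nat \<lfloor>r ^ k\<rfloor>"
          using independent_strong_power_card_le[OF fin u c \<open>r > 0\<close>] *
          by (intro independence_number_leI finite_strong_power fin) (simp add: le_nat_floor)
        then have "real (independence_number (strong_power G k)) \<le> r ^ k"
          using \<open>r > 0\<close> by (simp add: le_nat_iff le_floor_iff)
        then have "root k (real (independence_number (strong_power G k))) \<le> root k (r ^ k)"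
          using k by (intro real_root_le_mono) auto
        also have "\<dots> = r"
          using k \<open>r > 0\<close> by (intro real_root_power_cancel) auto
        finally show "root k (real (independence_number (strong_power G k))) \<le> r" .
      qed auto
      then show ?thesis using real by (simp add: ennreal_leI)
    qed
  qed
qed

section \<open>Positive semidefinite kernels as Gram matrices\<close>

text \<open>One step of the Cholesky decomposition: the Schur complement of the entry at \<open>a\<close> is again
  positive semidefinite. If that entry is \<open>0\<close>, then so is its whole row, and the convention
  \<open>x / 0 = 0\<close> makes the same formulas correct.\<close>

lemma gram_representation:
  fixes K :: "'a \<Rightarrow> 'a \<Rightarrow> real"
  assumes "finite V"
    and "\<And>i j. i \<in> V \<Longrightarrow> j \<in> V \<Longrightarrow> K i j = K j i"
    and "\<And>x. 0 \<le> (\<Sum>i\<in>V. \<Sum>j\<in>V. x i * x j * K i j)"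
  shows "\<exists>u. \<forall>i\<in>V. \<forall>j\<in>V. K i j = (\<Sum>l<card V. u i l * u j l :: real)"
  using assms
proof (induction V arbitrary: K rule: finite_induct)
  case empty
  then show ?case by simp
next
  case (insert a V)
  note sym = insert.prems(1) and psd = insert.prems(2)
  define q where "q = K a a"
  have expand: "(\<Sum>i\<in>insert a V. \<Sum>j\<in>insert a V. x i * x j * K i j)
     = (x a)\<^sup>2 * q + 2 * x a * (\<Sum>j\<in>V. x j * K a j) + (\<Sum>i\<in>V. \<Sum>j\<in>V. x i * x j * K i j)" for x
  proof -
    have "(\<Sum>i\<in>V. x i * x a * K i a) = x a * (\<Sum>j\<in>V. x j * K a j)"
      unfolding sum_distrib_left using sym by (intro sum.cong) auto
    moreover have "(\<Sum>j\<in>V. x a * x j * K a j) = x a * (\<Sum>j\<in>V. x j * K a j)"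
      unfolding sum_distrib_left by (simp add: mult_ac)
    ultimately show ?thesis
      using insert.hyps by (simp add: sum.distrib q_def power2_eq_square algebra_simps)
  qed
  have q0: "q \<ge> 0"
    using psd[of "\<lambda>i. if i = a then 1 else 0"] insert.hyps unfolding expand
    by (simp add: if_distrib[of "\<lambda>z. z * _"] cong: if_cong) 
      (smt (verit, best) mult_eq_0_iff sum.neutral)
  have row0: "K a j = 0" if "q = 0" "j \<in> V" for j
  proof (rule ccontr)
    assume nz: "K a j \<noteq> 0"
    have ja: "j \<noteq> a" using that insert.hyps by auto
    \<comment> \<open>With \<open>q = 0\<close> the form at \<open>t\<close> times the basis vector
      of \<open>a\<close> plus that of \<open>j\<close> is \<open>2 * t * K a j + K j j\<close>;
      this \<open>t\<close> makes it -1.\<close>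
    define t where "t = - (K j j + 1) / (2 * K a j)"
    have "0 \<le> 2 * t * K a j + K j j"
    proof -
      let ?x = "\<lambda>i. if i = a then t else if i = j then 1 else 0"
      have 1: "(\<Sum>i\<in>V. ?x i * K a i) = K a j"
      proof -
        have "(\<Sum>i\<in>V. ?x i * K a i) = (\<Sum>i\<in>V. if i = j then K a i else 0)"
          using insert.hyps by (intro sum.cong) auto
        then show ?thesis using that insert.hyps by simp
      qed
      have 2: "(\<Sum>i\<in>V. \<Sum>l\<in>V. ?x i * ?x l * K i l) = K j j"
      proof -
        have "(\<Sum>i\<in>V. \<Sum>l\<in>V. ?x i * ?x l * K i l)
            = (\<Sum>i\<in>V. if i = j then (\<Sum>l\<in>V. if l = j then K i l else 0) else 0)"
        proof (intro sum.cong refl)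
          fix i assume "i \<in> V"
          then have "(\<Sum>l\<in>V. ?x i * ?x l * K i l) = (\<Sum>l\<in>V. if i = j \<and> l = j then K i l else 0)"
            using insert.hyps by (intro sum.cong) auto
          then show "(\<Sum>l\<in>V. ?x i * ?x l * K i l)
              = (if i = j then (\<Sum>l\<in>V. if l = j then K i l else 0) else 0)" by auto
        qed
        then show ?thesis using that insert.hyps by simp
      qed
      show ?thesis using psd[of ?x] unfolding expand 1 2 using that(1) by simp
    qed
    also have "\<dots> = -1" using nz by (simp add: t_def field_simps)
    finally show False by simp
  qed
  define K' where "K' i j = K i j - K a i * K a j / q" for i j
  have psd': "0 \<le> (\<Sum>i\<in>V. \<Sum>j\<in>V. x i * x j * K' i j)" for x
  proof -
    define s where "s = (\<Sum>j\<in>V. x j * K a j)"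
    \<comment> \<open>For \<open>q > 0\<close> this value at \<open>a\<close> minimises the form of
      \<open>K\<close> with the other coordinates fixed, and the minimum is the form of
      \<open>K'\<close> at \<open>x\<close>.\<close>
    let ?x = "x(a := - s / q)"
    have 1: "(\<Sum>j\<in>V. ?x j * K a j) = s"
      unfolding s_def using insert.hyps by (intro sum.cong) auto
    have 2: "(\<Sum>i\<in>V. \<Sum>j\<in>V. ?x i * ?x j * K i j) = (\<Sum>i\<in>V. \<Sum>j\<in>V. x i * x j * K i j)"
      using insert.hyps by (intro sum.cong) auto
    have 3: "(\<Sum>i\<in>V. \<Sum>j\<in>V. x i * x j * K' i j) = (\<Sum>i\<in>V. \<Sum>j\<in>V. x i * x j * K i j) - s * s / q"
      unfolding s_def sum_product
      by (simp add: K'_def algebra_simps sum_subtractf sum_divide_distrib)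
    have "0 \<le> (- s / q)\<^sup>2 * q + 2 * (- s / q) * s + (\<Sum>i\<in>V. \<Sum>j\<in>V. x i * x j * K i j)"
      using psd[of ?x] unfolding expand 1 2 by simp
    also have "\<dots> = (\<Sum>i\<in>V. \<Sum>j\<in>V. x i * x j * K' i j)"
      unfolding 3 by (cases "q = 0") (auto simp: power2_eq_square field_simps)
    finally show ?thesis .
  qed
  have "\<exists>u. \<forall>i\<in>V. \<forall>j\<in>V. K' i j = (\<Sum>l<card V. u i l * u j l)"
    by (rule insert.IH[OF _ psd']) (use sym in \<open>auto simp: K'_def\<close>)
  then obtain u where u: "\<And>i j. i \<in> V \<Longrightarrow> j \<in> V \<Longrightarrow> K' i j = (\<Sum>l<card V. u i l * u j l)"
    by blast
  \<comment> \<open>The new last coordinate, of index \<open>card V\<close>, carries the rank-one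
    part removed from \<open>K\<close>; the vector of \<open>a\<close> lives in that coordinate
    alone.\<close>
  define u' where "u' i l = (if l < card V then if i = a then 0 else u i l else K a i / sqrt q)"
    for i l
  have "K i j = (\<Sum>l<card (insert a V). u' i l * u' j l)"
    if ij: "i \<in> insert a V" "j \<in> insert a V" for i j
  proof -
    have "(\<Sum>l<card (insert a V). u' i l * u' j l)
        = (\<Sum>l<card V. u' i l * u' j l) + K a i * K a j / q"
      using insert.hyps q0 by (simp add: u'_def)
    also have "(\<Sum>l<card V. u' i l * u' j l) = (if i = a \<or> j = a then 0 else K' i j)"
      using ij u by (auto simp: u'_def)
    also have "\<dots> + K a i * K a j / q = K i j"
    proof (cases "i = a \<or> j = a")
      case True
      then show ?thesis
      proof (cases "q = 0")
        case True
        have "K a l = 0" if "l \<in> insert a V" for l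
          using row0[OF True, of l] True that by (auto simp: q_def)
        then show ?thesis
          using \<open>i = a \<or> j = a\<close> True ij sym[of i j] by auto
      next
        case False
        then show ?thesis
          using \<open>i = a \<or> j = a\<close> ij sym[of i j] by (auto simp: q_def)
      qed
    qed (simp add: K'_def)
    finally show ?thesis by simp
  qed
  then show ?case by blast
qed

section \<open>Quadratic forms and the least eigenvalue of a symmetric matrix\<close>

lemma scalar_prod_self_nonneg: "0 \<le> x \<bullet> (x :: real vec)"
  unfolding scalar_prod_def by (intro sum_nonneg) simp

text \<open>A crude bound from \<bar>x_i x_j\<bar> \<le> x \<bullet> x. Only the existence of a
  constant matters: it controls the form of an inverse matrix, and shows that a large enough shift
  of a matrix is positive semidefinite.\<close>

lemma quadratic_form_le:
  fixes B :: "real mat"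
  assumes B: "B \<in> carrier_mat n n" and x: "x \<in> carrier_vec n"
  shows "x \<bullet> (B *\<^sub>v x) \<le> (\<Sum>i<n. \<Sum>j<n. \<bar>B $$ (i, j)\<bar>) * (x \<bullet> x)"
proof -
  have sq: "(x $ i)\<^sup>2 \<le> x \<bullet> x" if "i < n" for i
    using x that unfolding scalar_prod_def power2_eq_square
    by (intro member_le_sum[where f = "\<lambda>i. x $ i * x $ i"]) auto
  have "x \<bullet> (B *\<^sub>v x) = (\<Sum>i<n. \<Sum>j<n. x $ i * (B $$ (i, j) * x $ j))"
    using B x by (simp add: scalar_prod_def sum_distrib_left lessThan_atLeast0)
  also have "\<dots> \<le> (\<Sum>i<n. \<Sum>j<n. \<bar>B $$ (i, j)\<bar> * (x \<bullet> x))"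
  proof (intro sum_mono)
    fix i j assume ij: "i \<in> {..<n}" "j \<in> {..<n}"
    have "2 * \<bar>x $ i * x $ j\<bar> \<le> (x $ i)\<^sup>2 + (x $ j)\<^sup>2"
      using sum_squares_bound[of "\<bar>x $ i\<bar>" "\<bar>x $ j\<bar>"] by (simp add: abs_mult)
    then have "\<bar>x $ i * x $ j\<bar> \<le> x \<bullet> x" using sq[of i] sq[of j] ij by simp
    then have "\<bar>B $$ (i, j)\<bar> * \<bar>x $ i * x $ j\<bar> \<le> \<bar>B $$ (i, j)\<bar> * (x \<bullet> x)"
      by (intro mult_left_mono) auto
    moreover have "x $ i * (B $$ (i, j) * x $ j) \<le> \<bar>B $$ (i, j)\<bar> * \<bar>x $ i * x $ j\<bar>"
      by (simp add: mult_ac flip: abs_mult)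
    ultimately show "x $ i * (B $$ (i, j) * x $ j) \<le> \<bar>B $$ (i, j)\<bar> * (x \<bullet> x)" by simp
  qed
  finally show ?thesis by (simp add: sum_distrib_right)
qed

text \<open>Put \<open>y = L *\<^sub>v x\<close> with \<open>L\<close> the inverse of
  \<open>K\<close>. Nonnegativity of the form at \<open>x - s \<cdot>\<^sub>v y\<close> bounds
  \<open>x \<bullet> (K *\<^sub>v x)\<close> below by
  \<open>2 * s * (x \<bullet> x) - s * s * (x \<bullet> y)\<close>. Since
  \<open>x \<bullet> y \<le> C * (x \<bullet> x)\<close>, the choice \<open>s = 1 / C\<close> leaves
  \<open>s * (x \<bullet> x)\<close>.\<close>

lemma psd_invertible_coercive:
  fixes K :: "real mat"
  assumes K: "K \<in> carrier_mat n n" and sym: "transpose_mat K = K"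
    and psd: "\<And>x. x \<in> carrier_vec n \<Longrightarrow> 0 \<le> x \<bullet> (K *\<^sub>v x)"
    and det: "det K \<noteq> 0"
  shows "\<exists>e>0. \<forall>x\<in>carrier_vec n. e * (x \<bullet> x) \<le> x \<bullet> (K *\<^sub>v x)"
proof -
  from det_non_zero_imp_unit[OF K det, of "()"]
  obtain L where L: "L \<in> carrier_mat n n" and KL: "K * L = 1\<^sub>m n"
    unfolding Units_def ring_mat_def by auto
  \<comment> \<open>The added 1 keeps \<open>C\<close> positive even when the sum is empty.\<close>
  define C where "C = (\<Sum>i<n. \<Sum>j<n. \<bar>L $$ (i, j)\<bar>) + 1"
  have C: "C > 0" unfolding C_def by (intro add_nonneg_pos sum_nonneg) auto
  have "1 / C * (x \<bullet> x) \<le> x \<bullet> (K *\<^sub>v x)" if x: "x \<in> carrier_vec n" for x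
  proof -
    define y where "y = L *\<^sub>v x"
    define s where "s = 1 / C"
    have y: "y \<in> carrier_vec n" using L x by (simp add: y_def)
    have Kx: "K *\<^sub>v x \<in> carrier_vec n" using K x by simp
    have Ky: "K *\<^sub>v y = x"
      unfolding y_def using assoc_mult_mat_vec[OF K L x] KL x by simp
    have "x \<bullet> y \<le> (C - 1) * (x \<bullet> x)"
      using quadratic_form_le[OF L x] by (simp add: y_def C_def)
    then have xy: "x \<bullet> y \<le> C * (x \<bullet> x)"
      using scalar_prod_self_nonneg[of x] by (simp add: algebra_simps)
    have yKx: "y \<bullet> (K *\<^sub>v x) = x \<bullet> x"
      using transpose_vec_mult_scalar[OF K x y] sym Ky by simp
    have "0 \<le> (x - s \<cdot>\<^sub>v y) \<bullet> (K *\<^sub>v (x - s \<cdot>\<^sub>v y))"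
      using x y by (intro psd) simp
    also have "K *\<^sub>v (x - s \<cdot>\<^sub>v y) = K *\<^sub>v x - s \<cdot>\<^sub>v x"
      using K x y Ky by (simp add: mult_minus_distrib_mat_vec mult_mat_vec)
    also have "(x - s \<cdot>\<^sub>v y) \<bullet> (K *\<^sub>v x - s \<cdot>\<^sub>v x)
        = x \<bullet> (K *\<^sub>v x) - s * (x \<bullet> x) - s * (x \<bullet> x) + s * (s * (x \<bullet> y))"
      using x y Kx yKx comm_scalar_prod[OF x y]
      by (simp add: minus_scalar_prod_distrib[of _ n] scalar_prod_minus_distrib[of _ n] algebra_simps)
    also have "s * (x \<bullet> y) \<le> x \<bullet> x"
      using xy C by (simp add: s_def field_simps)
    then have "s * (s * (x \<bullet> y)) \<le> s * (x \<bullet> x)"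
      using C by (intro mult_left_mono) (auto simp: s_def)
    finally show ?thesis by (simp add: s_def)
  qed
  then show ?thesis using C by (intro exI[of _ "1 / C"]) auto
qed

text \<open>Let \<open>t\<close> be the least number for which \<open>A + t I\<close> is positive semidefinite. By minimality
  \<open>A + t I\<close> is not coercive, hence it is singular and \<open>- t\<close> is an eigenvalue of \<open>A\<close>.\<close>

lemma eigenvalue_bound_le_quadratic_form:
  fixes A :: "real mat"
  assumes A: "A \<in> carrier_mat n n" and sym: "transpose_mat A = A"
    and ev: "\<And>\<mu>. eigenvalue A \<mu> \<Longrightarrow> lam \<le> \<mu>"
    and x: "x \<in> carrier_vec n"
  shows "lam * (x \<bullet> x) \<le> x \<bullet> (A *\<^sub>v x)"
proof (cases "n = 0")
  case True
  then show ?thesis using x A by (simp add: scalar_prod_def)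
next
  case False
  define T where "T = {t. \<forall>x\<in>carrier_vec n. 0 \<le> x \<bullet> (A *\<^sub>v x) + t * (x \<bullet> x)}"
  \<comment> \<open>An upper bound for the form of \<open>- A\<close> is a lower bound for that of
    \<open>A\<close>.\<close>
  have "(\<Sum>i<n. \<Sum>j<n. \<bar>(- A) $$ (i, j)\<bar>) \<in> T"
  proof -
    have "0 \<le> x \<bullet> (A *\<^sub>v x) + (\<Sum>i<n. \<Sum>j<n. \<bar>(- A) $$ (i, j)\<bar>) * (x \<bullet> x)"
      if x: "x \<in> carrier_vec n" for x
    proof -
      have "x \<bullet> ((- A) *\<^sub>v x) = - (x \<bullet> (A *\<^sub>v x))"
        using A x by (simp add: uminus_mult_mat_vec)
      then show ?thesis using quadratic_form_le[of "- A" n x] A x by simp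
    qed
    then show ?thesis by (simp add: T_def)
  qed
  then have ne: "T \<noteq> {}" by blast
  let ?e = "unit_vec n 0 :: real vec"
  have e: "?e \<in> carrier_vec n" "?e \<bullet> ?e = 1" using False by auto
  have bdd: "bdd_below T"
  proof (rule bdd_belowI)
    fix s assume "s \<in> T"
    then have "0 \<le> ?e \<bullet> (A *\<^sub>v ?e) + s * (?e \<bullet> ?e)" using e(1) unfolding T_def by blast
    then show "- (?e \<bullet> (A *\<^sub>v ?e)) \<le> s" unfolding e(2) by simp
  qed
  define t where "t = Inf T"
  \<comment> \<open>The infimum is attained: each \<open>x\<close> with
    \<open>x \<bullet> x > 0\<close> only demands that \<open>t\<close> be at least minus its
    Rayleigh quotient, and for \<open>x \<bullet> x = 0\<close> the condition does not depend on
    \<open>t\<close>.\<close>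
  have tT: "t \<in> T"
    unfolding T_def
  proof (clarify)
    fix x :: "real vec" assume x: "x \<in> carrier_vec n"
    show "0 \<le> x \<bullet> (A *\<^sub>v x) + t * (x \<bullet> x)"
    proof (cases "x \<bullet> x = 0")
      case True
      obtain s where "s \<in> T" using ne by blast
      then have "0 \<le> x \<bullet> (A *\<^sub>v x) + s * (x \<bullet> x)" using x by (simp add: T_def)
      then show ?thesis using True by simp
    next
      case False
      then have pos: "x \<bullet> x > 0" using scalar_prod_self_nonneg[of x] by simp
      have "- (x \<bullet> (A *\<^sub>v x)) / (x \<bullet> x) \<le> t"
        unfolding t_def
      proof (rule cInf_greatest[OF ne])
        fix s assume "s \<in> T"
        then have "0 \<le> x \<bullet> (A *\<^sub>v x) + s * (x \<bullet> x)" using x by (simp add: T_def)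
        then show "- (x \<bullet> (A *\<^sub>v x)) / (x \<bullet> x) \<le> s" using pos by (simp add: field_simps)
      qed
      then show ?thesis using pos by (simp add: field_simps)
    qed
  qed
  define K where "K = A + t \<cdot>\<^sub>m 1\<^sub>m n"
  have K: "K \<in> carrier_mat n n" using A by (simp add: K_def)
  have Kv: "K *\<^sub>v x = A *\<^sub>v x + t \<cdot>\<^sub>v x" if "x \<in> carrier_vec n" for x
  proof -
    have "(t \<cdot>\<^sub>m 1\<^sub>m n) *\<^sub>v x = t \<cdot>\<^sub>v x"
      using that by (intro eq_vecI) auto
    then show ?thesis
      using A that by (simp add: K_def add_mult_distrib_mat_vec[of _ n n])
  qed
  have Kform: "x \<bullet> (K *\<^sub>v x) = x \<bullet> (A *\<^sub>v x) + t * (x \<bullet> x)" if "x \<in> carrier_vec n" for x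
    using A that by (simp add: Kv scalar_prod_add_distrib[of _ n])
  have Ksym: "transpose_mat K = K"
  proof -
    have "transpose_mat (t \<cdot>\<^sub>m 1\<^sub>m n) = t \<cdot>\<^sub>m 1\<^sub>m n" by (rule eq_matI) auto
    then show ?thesis using sym A by (simp add: K_def transpose_add[of _ n n])
  qed
  have "det K = 0"
  proof (rule ccontr)
    assume "det K \<noteq> 0"
    then obtain e where "e > 0"
      and e: "\<And>x. x \<in> carrier_vec n \<Longrightarrow> e * (x \<bullet> x) \<le> x \<bullet> (K *\<^sub>v x)"
      using psd_invertible_coercive[OF K Ksym] tT by (auto simp: Kform T_def)
    have "0 \<le> x \<bullet> (A *\<^sub>v x) + (t - e) * (x \<bullet> x)" if "x \<in> carrier_vec n" for x
      using e[OF that] Kform[OF that] by (simp add: algebra_simps)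
    then have "t - e \<in> T" by (simp add: T_def)
    then have "t \<le> t - e" unfolding t_def by (rule cInf_lower[OF _ bdd])
    then show False using \<open>e > 0\<close> by simp
  qed
  then obtain v where v: "v \<in> carrier_vec n" "v \<noteq> 0\<^sub>v n" "K *\<^sub>v v = 0\<^sub>v n"
    using det_0_iff_vec_prod_zero_field[OF K] by blast
  have "A *\<^sub>v v = (- t) \<cdot>\<^sub>v v"
  proof (rule eq_vecI)
    fix i assume "i < dim_vec ((- t) \<cdot>\<^sub>v v)"
    then have i: "i < n" using v by simp
    have "(A *\<^sub>v v + t \<cdot>\<^sub>v v) $ i = 0" using v i Kv by (metis index_zero_vec(1))
    then show "(A *\<^sub>v v) $ i = ((- t) \<cdot>\<^sub>v v) $ i" using i v A by simp
  qed (use A v in auto)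
  then have "eigenvalue A (- t)"
    using v A by (auto simp: eigenvalue_def eigenvector_def)
  then have "lam \<le> - t" by (rule ev)
  then have "lam * (x \<bullet> x) \<le> - t * (x \<bullet> x)"
    by (intro mult_right_mono scalar_prod_self_nonneg)
  then show ?thesis using tT x by (auto simp: T_def)
qed

section \<open>The representation with Gram matrix \<open>I - A / lam\<close> and its value\<close>

text \<open>As \<open>lam\<close> is negative, nonnegativity of
  \<open>y \<bullet> y - (y \<bullet> (A *\<^sub>v y)) / lam\<close> is the bound
  \<open>lam * (y \<bullet> y) \<le> y \<bullet> (A *\<^sub>v y)\<close> given by the least
  eigenvalue.\<close>

lemma adjacency_gram_representation:
  assumes G: "pair_graph G"
    and vs: "distinct vs" "set vs = pverts G"
    and ev: "\<And>\<mu>. eigenvalue (adjacency_matrix G vs) \<mu> \<Longrightarrow> lam \<le> \<mu>"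
    and lam: "lam < 0"
  shows "\<exists>u. \<forall>i\<in>pverts G. u i \<in> carrier_vec (card (pverts G)) \<and> (\<forall>j\<in>pverts G.
    u i \<bullet> u j = (if i = j then 1 else 0) - (if (i, j) \<in> parcs G then 1 else 0) / lam)"
proof -
  interpret pair_graph G by fact
  let ?A = "adjacency_matrix G vs" and ?V = "pverts G" and ?n = "length vs"
  define e where "e i j = (if (i, j) \<in> parcs G then 1 else 0 :: real)" for i j
  define K where "K i j = (if i = j then 1 else 0) - e i j / lam" for i j
  have esym: "e i j = e j i" for i j
    using pair_sym_arcs by (auto simp: e_def symmetric_def dest: symD)
  have A: "?A \<in> carrier_mat ?n ?n" by (simp add: adjacency_matrix_def)
  have Aij: "?A $$ (i, j) = e (vs ! i) (vs ! j)" if "i < ?n" "j < ?n" for i j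
    using that by (simp add: adjacency_matrix_def e_def)
  have Asym: "transpose_mat ?A = ?A"
    by (rule eq_matI) (use A Aij esym in auto)
  \<comment> \<open>Matrix sums run over positions in \<open>vs\<close>, kernel sums over vertices;
    this bijection converts between them.\<close>
  have bij: "bij_betw ((!) vs) {0..<?n} ?V"
    using bij_betw_nth[OF vs(1) _ vs(2)[symmetric]] by (simp add: lessThan_atLeast0)
  have "0 \<le> (\<Sum>i\<in>?V. \<Sum>j\<in>?V. x i * x j * K i j)" for x
  proof -
    define y where "y = vec ?n (\<lambda>i. x (vs ! i))"
    have y: "y \<in> carrier_vec ?n" by (simp add: y_def)
    have yy: "y \<bullet> y = (\<Sum>i\<in>?V. x i * x i)"
      unfolding sum.reindex_bij_betw[OF bij, symmetric] by (simp add: y_def scalar_prod_def)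
    have yAy: "y \<bullet> (?A *\<^sub>v y) = (\<Sum>i\<in>?V. \<Sum>j\<in>?V. x i * (e i j * x j))"
      unfolding sum.reindex_bij_betw[OF bij, symmetric]
      using A Aij by (simp add: y_def scalar_prod_def sum_distrib_left)
    have "(\<Sum>i\<in>?V. \<Sum>j\<in>?V. x i * x j * K i j)
        = (\<Sum>i\<in>?V. \<Sum>j\<in>?V. (if i = j then x i * x j else 0) - x i * (e i j * x j) / lam)"
      by (intro sum.cong) (auto simp: K_def algebra_simps)
    also have "\<dots> = y \<bullet> y - (y \<bullet> (?A *\<^sub>v y)) / lam"
      by (simp add: yy yAy sum_subtractf sum_divide_distrib)
    finally show ?thesis
      using eigenvalue_bound_le_quadratic_form[OF A Asym ev y] lam
      by (simp add: divide_le_eq mult.commute)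
  qed
  then have "\<exists>U. \<forall>i\<in>?V. \<forall>j\<in>?V. K i j = (\<Sum>l<card ?V. U i l * U j l)"
    by (intro gram_representation) (auto simp: K_def esym)
  then obtain U where U: "\<And>i j. i \<in> ?V \<Longrightarrow> j \<in> ?V \<Longrightarrow> K i j = (\<Sum>l<card ?V. U i l * U j l)"
    by blast
  show ?thesis
    by (rule exI[of _ "\<lambda>i. vec (card ?V) (U i)"])
      (use U in \<open>auto simp: scalar_prod_def lessThan_atLeast0 K_def e_def\<close>)
qed

lemma lovasz_number_le_card:
  assumes G: "pair_graph G"
    and vs: "distinct vs" "set vs = pverts G"
    and ev: "\<And>\<mu>. eigenvalue (adjacency_matrix G vs) \<mu> \<Longrightarrow> lam \<le> \<mu>"
    and lam: "lam < 0"
    and S: "independent_set G S"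
    and nbrs: "\<And>i. i \<in> pverts G - S \<Longrightarrow> real (card {j \<in> S. (i, j) \<in> parcs G}) \<ge> - lam"
    and ne: "pverts G \<noteq> {}"
  shows "lovasz_number G \<le> of_nat (card S)"
proof -
  interpret pair_graph G by fact
  let ?V = "pverts G" and ?n = "card (pverts G)"
  obtain u where ucar: "\<And>i. i \<in> ?V \<Longrightarrow> u i \<in> carrier_vec ?n"
    and uu: "\<And>i j. i \<in> ?V \<Longrightarrow> j \<in> ?V \<Longrightarrow>
      u i \<bullet> u j = (if i = j then 1 else 0) - (if (i, j) \<in> parcs G then 1 else 0) / lam"
    using adjacency_gram_representation[OF G vs ev lam] by blast
  have SV: "S \<subseteq> ?V" and SS: "\<And>i j. i \<in> S \<Longrightarrow> j \<in> S \<Longrightarrow> (i, j) \<notin> parcs G"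
    using S by (auto simp: independent_set_def)
  have finS: "finite S" by (rule finite_subset[OF SV pair_finite_verts])
  \<comment> \<open>Were \<open>S\<close> empty, any vertex would have no neighbour in
    \<open>S\<close>, against the lower bound \<open>- lam > 0\<close>.\<close>
  have "S \<noteq> {}"
  proof
    assume "S = {}"
    moreover obtain i where "i \<in> ?V" using ne by blast
    ultimately show False using nbrs[of i] lam by simp
  qed
  then have m: "card S > 0" using finS by (simp add: card_gt_0_iff)
  have noloop: "(i, i) \<notin> parcs G" for i using pair_no_loops[of "(i, i)"] by auto
  have rep: "orthonormal_representation G ?n u"
    unfolding orthonormal_representation_def unit_vecs_def using ucar uu noloop by auto
  \<comment> \<open>The norm of the sum of the card S orthonormal vectors
    \<open>u s\<close>.\<close>
  define r where "r = sqrt (real (card S))"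
  have r: "r > 0" "r * r = real (card S)" using m by (auto simp: r_def)
  define c where "c = vec ?n (\<lambda>l. (\<Sum>s\<in>S. u s $ l) / r)"
  have c: "c \<in> carrier_vec ?n" by (simp add: c_def)
  have cx: "c \<bullet> x = (\<Sum>s\<in>S. u s \<bullet> x) / r" if "x \<in> carrier_vec ?n" for x
  proof -
    have "c \<bullet> x = (\<Sum>l\<in>{0..<?n}. \<Sum>s\<in>S. u s $ l * x $ l / r)"
      using that by (simp add: c_def scalar_prod_def sum_distrib_right sum_divide_distrib)
    also have "\<dots> = (\<Sum>s\<in>S. \<Sum>l\<in>{0..<?n}. u s $ l * x $ l / r)" by (rule sum.swap)
    finally show ?thesis
      using that by (simp add: scalar_prod_def sum_divide_distrib)
  qed
  have cS: "c \<bullet> u i = 1 / r" if "i \<in> S" for i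
  proof -
    have "u s \<bullet> u i = (if s = i then 1 else 0)" if "s \<in> S" for s
      using uu[of s i] SS[of s i] subsetD[OF SV] \<open>i \<in> S\<close> that by auto
    then have "(\<Sum>s\<in>S. u s \<bullet> u i) = (\<Sum>s\<in>S. if s = i then 1 else 0)" by simp
    then show ?thesis using that finS SV ucar by (auto simp: cx)
  qed
  have cV: "c \<bullet> u i \<ge> 1 / r" if "i \<in> ?V" for i
  proof (cases "i \<in> S")
    case False
    let ?N = "{j \<in> S. (i, j) \<in> parcs G}"
    have sym: "(s, i) \<in> parcs G \<longleftrightarrow> (i, s) \<in> parcs G" for s
      using pair_sym_arcs by (auto simp: symmetric_def dest: symD)
    \<comment> \<open>Each neighbour of \<open>i\<close> in \<open>S\<close> contributes
      \<open>- 1 / lam\<close>, so at least \<open>- lam\<close> of them contribute at least 1 in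
      total.\<close>
    have "(\<Sum>s\<in>S. u s \<bullet> u i) = (\<Sum>s\<in>S. if (i, s) \<in> parcs G then - 1 / lam else 0)"
      using SV False that uu sym by (intro sum.cong) auto
    also have "\<dots> = real (card ?N) * (- 1 / lam)"
      using finS by (simp add: sum.If_cases Collect_conj_eq Int_commute)
    also have "\<dots> \<ge> 1" using nbrs[of i] that False lam by (simp add: field_simps)
    finally show ?thesis using that ucar r by (simp add: cx divide_right_mono)
  qed (simp add: cS)
  have "c \<bullet> c = (\<Sum>s\<in>S. c \<bullet> u s) / r"
    unfolding cx[OF c] using SV ucar comm_scalar_prod[OF c]
    by (intro arg_cong2[where f = "(/)"] sum.cong) auto
  also have "\<dots> = 1" using r m by (simp add: cS)
  finally have cu: "c \<in> unit_vecs ?n" using c by (simp add: unit_vecs_def)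
  have "1 / ennreal ((c \<bullet> u i)\<^sup>2) \<le> of_nat (card S)" if "i \<in> ?V" for i
  proof -
    have "(1 / r)\<^sup>2 \<le> (c \<bullet> u i)\<^sup>2"
      using cV[OF that] r by (intro power_mono) auto
    then have le: "1 / real (card S) \<le> (c \<bullet> u i)\<^sup>2"
      using r by (simp add: power2_eq_square)
    have pos: "0 < (c \<bullet> u i)\<^sup>2" using le m by (smt (verit) of_nat_0_less_iff zero_less_divide_1_iff)
    have "1 / (c \<bullet> u i)\<^sup>2 \<le> real (card S)"
      using le pos m by (simp add: field_simps)
    then have "ennreal (1 / (c \<bullet> u i)\<^sup>2) \<le> ennreal (real (card S))" by (rule ennreal_leI)
    then show ?thesis using pos by (simp add: divide_ennreal ennreal_of_nat_eq_real_of_nat flip: ennreal_1)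
  qed
  then have max: "(MAX i\<in>?V. 1 / ennreal ((c \<bullet> u i)\<^sup>2)) \<le> of_nat (card S)"
    using ne by (subst Max_le_iff) auto
  have "lovasz_number G \<le> representation_value G ?n u"
    unfolding lovasz_number_def using rep by (intro Inf_lower) blast
  also have "\<dots> \<le> (MAX i\<in>?V. 1 / ennreal ((c \<bullet> u i)\<^sup>2))"
    unfolding representation_value_def by (rule INF_lower[OF cu])
  finally show ?thesis using max by (rule order_trans)
qed

theorem theorem4p2:
  fixes G :: "'a pair_pre_digraph" and vs :: "'a list" and S :: "'a set" and lam :: real
  assumes "pair_graph G"
    and "distinct vs" and "set vs = pverts G"
    and "eigenvalue (adjacency_matrix G vs) lam"
    and "\<And>\<mu>. eigenvalue (adjacency_matrix G vs) \<mu> \<Longrightarrow> lam \<le> \<mu>"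
    and "lam < 0"
    and "independent_set G S"
    and "\<And>i. i \<in> pverts G - S \<Longrightarrow> real (card {j \<in> S. (i, j) \<in> parcs G}) \<ge> - lam"
  shows "independence_number G = card S \<and>
         shannon_capacity G = real (card S) \<and>
         lovasz_number G = of_nat (card S)"
proof -
  interpret pair_graph G by fact
  \<comment> \<open>Having an eigenvalue forces positive dimension, so \<open>G\<close> has a
    vertex.\<close>
  have "length vs > 0"
    by (rule eigenvalue_imp_nonzero_dim[OF _ assms(4)]) (simp add: adjacency_matrix_def)
  then have ne: "pverts G \<noteq> {}" using assms(3) by auto
  have 1: "card S \<le> independence_number G"
    by (rule card_le_independence_number) (use assms(7) in auto)
  have 2: "real (independence_number G) \<le> shannon_capacity G"
    by (rule independence_number_le_shannon_capacity) auto
  have 3: "ennreal (shannon_capacity G) \<le> lovasz_number G"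
    by (rule shannon_capacity_le_lovasz_number) (use ne in auto)
  have 4: "lovasz_number G \<le> of_nat (card S)"
    by (rule lovasz_number_le_card[OF assms(1-3,5-8) ne])
  have "ennreal (shannon_capacity G) \<le> ennreal (real (card S))"
    using order_trans[OF 3 4] by (simp add: ennreal_of_nat_eq_real_of_nat)
  then have 5: "shannon_capacity G \<le> real (card S)"
    by (simp add: ennreal_le_iff)
  have S: "shannon_capacity G = real (card S)" using 1 2 5 by linarith
  moreover have "independence_number G = card S" using 1 2 5 by linarith
  moreover have "lovasz_number G = of_nat (card S)"
    using 3 4 unfolding S by (simp add: ennreal_of_nat_eq_real_of_nat)
  ultimately show ?thesis by blast
qed

end
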